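(* For all integers $k\ge 1$ and $g\ge 0$, $$\epsilon_g(k,2) = 2^k\cdot k!\cdot \epsilon_g(k).$$
   Context: An $m$-gon is an oriented closed disk whose boundary circle is divided into $m$ arcs (its sides), which are distinguishable; $m=1,2$ are allowed. The number $\epsilon_g(k)$ (one argument): number of ways to pair up the $2k$ sides of a single $2k$-gon (perfect matchings of the sides) such that, identifying the two sides of each pair without twist (so that the resulting surface is orientable), one obtains a closed surface of genus $g$. The number $\epsilon_g(k,M)$ (two arguments), used here with $M=2$: take one $kM$-gon and $k$ distinct (labelled) $M$-gons. A bipartite pairing is a bijection between the $kM$ sides of the $kM$-gon and the $kM$ sides of the $k$ $M$-gons altogether. Given such a pairing, each pair of sides is identified as one edge without twist (compatibly with the orientations of the polygons), which yields a closed connected orientable surface. $\epsilon_g(k,M)$ is the number of bipartite pairings for which the resulting surface has genus $g$. *)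

theory Defs
  imports "HOL-Analysis.Analysis"
begin

definition quotient_topology :: "'a topology \<Rightarrow> ('a \<times> 'a) set \<Rightarrow> 'a set topology" where
  "quotient_topology X r =
     topology (\<lambda>U. U \<subseteq> topspace X // r \<and> openin X {x \<in> topspace X. r `` {x} \<in> U})"

lemma openin_quotient_topology:
  "openin (quotient_topology X r) U \<longleftrightarrow>
     U \<subseteq> topspace X // r \<and> openin X {x \<in> topspace X. r `` {x} \<in> U}"
proof -
  have int: "{x \<in> topspace X. r `` {x} \<in> S \<inter> T} =
      {x \<in> topspace X. r `` {x} \<in> S} \<inter> {x \<in> topspace X. r `` {x} \<in> T}" for S T
    by auto
  have un: "{x \<in> topspace X. r `` {x} \<in> \<Union>K} = (\<Union>S\<in>K. {x \<in> topspace X. r `` {x} \<in> S})" for K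
    by auto
  have "istopology (\<lambda>U. U \<subseteq> topspace X // r \<and> openin X {x \<in> topspace X. r `` {x} \<in> U})"
    unfolding istopology_def int un by blast
  then show ?thesis
    by (simp add: quotient_topology_def)
qed

lemma topspace_quotient_topology [simp]:
  "topspace (quotient_topology X r) = topspace X // r"
proof -
  have "{x \<in> topspace X. r `` {x} \<in> topspace X // r} = topspace X"
    by (auto simp: quotient_def)
  then have "openin (quotient_topology X r) (topspace X // r)"
    by (simp add: openin_quotient_topology)
  then show ?thesis
    by (metis openin_quotient_topology openin_subset openin_topspace subset_antisym)
qed

lemma quotient_map_quotient_topology:
  "quotient_map X (quotient_topology X r) (\<lambda>x. r `` {x})"
  by (auto simp: quotient_map_def openin_quotient_topology quotient_def)

text \<open>The genus of a closed connected orientable surface, following Riemann: the maximal number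
  of pairwise disjoint simple closed curves whose union does not disconnect the surface. The
  case \<open>n = 0\<close> of the first predicate says that the surface itself is connected.\<close>

definition nonseparating_curves :: "'a topology \<Rightarrow> nat \<Rightarrow> bool" where
  "nonseparating_curves S n \<longleftrightarrow>
     (\<exists>C :: nat \<Rightarrow> 'a set.
        (\<forall>i<n. C i \<subseteq> topspace S \<and>
           subtopology S (C i) homeomorphic_space top_of_set (sphere (0::complex) 1)) \<and>
        disjoint_family_on C {..<n} \<and>
        connected_space (subtopology S (topspace S - (\<Union>i<n. C i))))"

definition has_genus :: "'a topology \<Rightarrow> nat \<Rightarrow> bool" where
  "has_genus S g \<longleftrightarrow>
     nonseparating_curves S g \<and> (\<forall>n. nonseparating_curves S n \<longrightarrow> n \<le> g)"

text \<open>A finite family of polygons is given by an index set \<open>J\<close> and the numbers \<open>n j\<close> of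
  sides. The underlying disk of each polygon is the closed unit disk with its counterclockwise
  orientation, and \<open>(j, i)\<close> with \<open>i < n j\<close> stands for the side of the polygon \<open>j\<close> that is the arc
  from angle \<open>2\<pi>i / n j\<close> to angle \<open>2\<pi>(i+1) / n j\<close>.\<close>

definition polygons :: "nat set \<Rightarrow> (nat \<times> complex) topology" where
  "polygons J = sum_topology (\<lambda>_. top_of_set (cball 0 1)) J"

definition sides :: "(nat \<Rightarrow> nat) \<Rightarrow> nat set \<Rightarrow> (nat \<times> nat) set" where
  "sides n J = (SIGMA j:J. {..<n j})"

definition side_point :: "(nat \<Rightarrow> nat) \<Rightarrow> nat \<times> nat \<Rightarrow> real \<Rightarrow> nat \<times> complex" where
  "side_point n s t = (fst s, cis (2 * pi * (real (snd s) + t) / real (n (fst s))))"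

text \<open>The set \<open>G\<close> consists of the (ordered) pairs of sides to be identified. All sides are
  parametrised counterclockwise, so an untwisted identification reverses the parameter.\<close>

definition glue_points ::
  "(nat \<Rightarrow> nat) \<Rightarrow> ((nat \<times> nat) \<times> (nat \<times> nat)) set \<Rightarrow> nat \<times> complex \<Rightarrow> nat \<times> complex \<Rightarrow> bool" where
  "glue_points n G x y \<longleftrightarrow>
     (\<exists>s s' t. (s, s') \<in> G \<and> 0 \<le> t \<and> t \<le> 1 \<and>
        x = side_point n s t \<and> y = side_point n s' (1 - t))"

definition glued_surface ::
  "(nat \<Rightarrow> nat) \<Rightarrow> nat set \<Rightarrow> ((nat \<times> nat) \<times> (nat \<times> nat)) set \<Rightarrow> (nat \<times> complex) set topology" where
  "glued_surface n J G =
     quotient_topology (polygons J)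
       {(x, y). x \<in> topspace (polygons J) \<and> y \<in> topspace (polygons J) \<and>
                equivclp (glue_points n G) x y}"

definition perfect_matchings :: "'a set \<Rightarrow> 'a set set set" where
  "perfect_matchings A = {P. partition_on A P \<and> (\<forall>e\<in>P. card e = 2)}"

definition eps :: "nat \<Rightarrow> nat \<Rightarrow> nat" where
  "eps g k =
     (let n = (\<lambda>_. 2 * k) in
      card {P \<in> perfect_matchings (sides n {0}).
              has_genus (glued_surface n {0} {(s, s'). {s, s'} \<in> P}) g})"

text \<open>In the bipartite case polygon \<open>0\<close> is the \<open>kM\<close>-gon and polygons \<open>1, \<dots>, k\<close> are the \<open>M\<close>-gons.
  Pairings are taken in the extensional function space, so that each bijection
  is counted once.\<close>

definition eps_bip :: "nat \<Rightarrow> nat \<Rightarrow> nat \<Rightarrow> nat" where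
  "eps_bip g k M =
     (let n = (\<lambda>j. if j = 0 then k * M else M) in
      card {f \<in> sides n {0} \<rightarrow>\<^sub>E sides n {1..k}.
              bij_betw f (sides n {0}) (sides n {1..k}) \<and>
              has_genus (glued_surface n {0..k} {(s, f s) |s. s \<in> sides n {0}}) g})"

end

theory Submission
  imports Defs
begin

text \<open>
  A bigon glued into a surface along both of its sides can be collapsed onto an arc, so that its two
  neighbours become glued to each other. A bijection \<open>f\<close> from the sides of the \<open>2k\<close>-gon to
  the sides of the \<open>k\<close> bigons therefore yields the same surface as the perfect matching of the sides
  of the \<open>2k\<close>-gon that pairs the two sides sent to the same bigon: going from one of them through the
  bigon to the other reverses the orientation of the parameter twice by the two gluings and once by the
  bigon itself, so that the resulting identification is again untwisted. A given perfect matching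
  comes from \<open>k!\<close> assignments of its pairs to the bigons, and from two ways to attach each
  pair to its bigon, which gives the factor \<open>2^k k!\<close>.

  The collapse itself is not injective, so the homeomorphism is obtained from a different map,
  \<open>flatten\<close>: near every side glued to side \<open>0\<close> of a bigon, a lens is removed from the \<open>2k\<close>-gon by
  shrinking the disk radially (\<open>carve\<close>), and the bigon is mapped onto that lens (\<open>fill\<close>), its side \<open>0\<close>
  going to the inner boundary of the lens and its side \<open>1\<close> to the outer boundary. This is a continuous
  surjection of a compact space onto a disk, hence a quotient map (\<open>quotient_map_polygons\<close>). Two points
  become equal in the surface of the bigons exactly if their images become equal in the surface of the
  matching (\<open>bigon_equiv_imp_matching_equiv\<close>, \<open>matching_equiv_imp_bigon_equiv\<close>), so the two quotients
  are homeomorphic (\<open>glued_bigons_homeomorphic\<close>) and have the same genus. The number of bijections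
  over a matching is \<open>card_bijections_with_fibre_matching\<close>.
\<close>

section \<open>Polar coordinates adapted to the sides of a polygon\<close>

text \<open>The angle is measured in sides: \<open>\<tau> = i + t\<close> is the point with parameter \<open>t\<close> on the side \<open>i\<close>
  of an \<open>N\<close>-gon.\<close>

definition polar :: "nat \<Rightarrow> real \<Rightarrow> real \<Rightarrow> complex" where
  "polar N r \<tau> = of_real r * cis (2 * pi * \<tau> / real N)"

lemma norm_polar: "norm (polar N r \<tau>) = \<bar>r\<bar>"
  by (simp add: polar_def norm_mult)

lemma Arg2pi_polar:
  assumes "N > 0" "r > 0" "0 \<le> \<tau>" "\<tau> < real N"
  shows "Arg2pi (polar N r \<tau>) = 2 * pi * \<tau> / real N"
  by (rule Arg2pi_unique[of r]) (use assms in \<open>auto simp: polar_def cis_conv_exp field_simps\<close>)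

lemma polar_eq_polar_iff:
  assumes "N > 0" "r > 0" "0 \<le> \<tau>" "\<tau> < real N" "r' > 0" "0 \<le> \<tau>'" "\<tau>' < real N"
  shows "polar N r \<tau> = polar N r' \<tau>' \<longleftrightarrow> r = r' \<and> \<tau> = \<tau>'"
proof
  assume eq: "polar N r \<tau> = polar N r' \<tau>'"
  have "r = r'" using arg_cong[OF eq, of norm] assms by (simp add: norm_polar)
  moreover have "2 * pi * \<tau> / real N = 2 * pi * \<tau>' / real N"
    using arg_cong[OF eq, of Arg2pi] assms by (simp add: Arg2pi_polar)
  ultimately show "r = r' \<and> \<tau> = \<tau>'" using assms by simp
qed auto

lemma polar_cover:
  assumes "N > 0" "z \<in> cball 0 1"
  obtains r \<tau> where "0 \<le> r" "r \<le> 1" "0 \<le> \<tau>" "\<tau> < real N" "z = polar N r \<tau>"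
proof
  show "z = polar N (norm z) (real N * Arg2pi z / (2 * pi))"
    using Arg2pi_eq[of z] assms(1) by (simp add: polar_def cis_conv_exp)
  show "real N * Arg2pi z / (2 * pi) < real N"
    using assms Arg2pi_lt_2pi[of z] by (simp add: field_simps)
  show "norm z \<le> 1" using assms by simp
qed (use assms in \<open>auto simp: Arg2pi_ge_0\<close>)

lemma polar_add_period:
  assumes "N > 0"
  shows "polar N r (\<tau> + of_int m * real N) = polar N r \<tau>"
proof -
  have "2 * pi * (\<tau> + of_int m * real N) / real N = 2 * pi * \<tau> / real N + 2 * pi * of_int m"
    using assms by (simp add: field_simps)
  then show ?thesis
    by (simp add: polar_def cis_mult[symmetric] cis_multiple_2pi)
qed

section \<open>Removing lenses from a disk and filling them\<close>

text \<open>The radial thickness of the lenses at the sides in \<open>A\<close>. It vanishes at the corners, which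
  makes it continuous although membership in \<open>A\<close> jumps there, and it is at most \<open>1/2\<close>, so that
  the lenses stay away from the centre of the disk.\<close>
definition lens_depth :: "nat set \<Rightarrow> nat \<Rightarrow> real \<Rightarrow> real" where
  "lens_depth A N \<tau> = (if nat (\<lfloor>\<tau>\<rfloor> mod int N) \<in> A then \<bar>sin (pi * \<tau>)\<bar> / 2 else 0)"

lemma lens_depth_bounds: "0 \<le> lens_depth A N \<tau>" "lens_depth A N \<tau> \<le> 1/2"
  by (auto simp: lens_depth_def)

lemma lens_depth_add_period:
  "lens_depth A N (\<tau> + of_int m * real N) = lens_depth A N \<tau>"
proof -
  have "\<lfloor>\<tau> + of_int m * real N\<rfloor> = \<lfloor>\<tau>\<rfloor> + m * int N"
    by (metis floor_add_int of_int_mult of_int_of_nat_eq)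
  moreover have "sin (pi * of_int (m * int N)) = 0"
    by (rule sin_npi_int)
  then have "sin (pi * (\<tau> + of_int m * real N)) = sin (pi * \<tau>) * cos (pi * of_int (m * int N))"
    by (simp add: distrib_left sin_add)
  moreover have "\<bar>cos (pi * of_int (m * int N))\<bar> = 1"
    by (intro sin_zero_abs_cos_one sin_npi_int)
  ultimately show ?thesis
    by (simp add: lens_depth_def abs_mult)
qed

lemma lens_depth_side:
  assumes "i < N" "0 \<le> t" "t \<le> 1"
  shows "lens_depth A N (real i + t) = (if i \<in> A then sin (pi * t) / 2 else 0)"
proof (cases "t = 1")
  case True
  have "sin (pi * (real i + 1)) = 0"
    by (metis of_nat_Suc sin_npi2 add.commute)
  then show ?thesis
    using True by (simp add: lens_depth_def)
next
  case False
  with assms have fl: "\<lfloor>real i + t\<rfloor> = int i" by linarith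
  have "sin (pi * (real i + t)) = cos (pi * real i) * sin (pi * t)"
    by (simp add: distrib_left sin_add)
  moreover have "\<bar>cos (pi * real i)\<bar> = 1"
    by (simp add: cos_npi2)
  moreover have "sin (pi * t) \<ge> 0"
    using assms by (intro sin_ge_zero) auto
  ultimately show ?thesis
    using assms(1) by (simp add: lens_depth_def fl abs_mult)
qed

text \<open>Away from the integers only the sine varies; at an integer the sine forces the value to tend
  to \<open>0\<close>, whichever of the adjacent sides belong to \<open>A\<close>.\<close>
lemma continuous_lens_depth: "continuous_on UNIV (lens_depth A N)"
proof (intro continuous_at_imp_continuous_on ballI)
  fix x :: real
  show "isCont (lens_depth A N) x"
  proof (cases "x \<in> \<int>")
    case True
    then have s0: "sin (pi * x) = 0"
      by (metis Ints_cases sin_npi_int)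
    have "((\<lambda>y. sin (pi * y)) \<longlongrightarrow> sin (pi * x)) (at x)"
      by (intro tendsto_intros)
    then have "((\<lambda>y. sin (pi * y)) \<longlongrightarrow> 0) (at x)"
      using s0 by simp
    then have "(lens_depth A N \<longlongrightarrow> 0) (at x)"
      by (rule tendsto_0_le[where K = 1]) (auto simp: lens_depth_def)
    moreover have "lens_depth A N x = 0"
      using s0 by (simp add: lens_depth_def)
    ultimately show ?thesis
      by (simp add: isCont_def)
  next
    case False
    define U where "U = {of_int \<lfloor>x\<rfloor><..<of_int \<lfloor>x\<rfloor> + 1 :: real}"
    define c where "c = (if nat (\<lfloor>x\<rfloor> mod int N) \<in> A then 1/2 else (0::real))"
    have "continuous_on U (\<lambda>y. \<bar>sin (pi * y)\<bar> * c)"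
      by (intro continuous_intros)
    moreover have "lens_depth A N y = \<bar>sin (pi * y)\<bar> * c" if "y \<in> U" for y
    proof -
      have "\<lfloor>y\<rfloor> = \<lfloor>x\<rfloor>" using that unfolding U_def by (simp add: floor_eq_iff)
      then show ?thesis by (simp add: lens_depth_def c_def)
    qed
    ultimately have "continuous_on U (lens_depth A N)"
      by (simp cong: continuous_on_cong)
    moreover have "x \<in> U"
    proof -
      have "x \<noteq> of_int \<lfloor>x\<rfloor>" using False by (metis Ints_of_int)
      then show ?thesis unfolding U_def
        by simp (metis of_int_floor_le order_le_less)
    qed
    ultimately show ?thesis
      by (metis U_def continuous_on_eq_continuous_at open_greaterThanLessThan)
  qed
qed

text \<open>Shrinks each radius by a factor that depends on the direction only, so that exactly the lenses
  are missing from the image of the disk.\<close>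
definition carve :: "nat set \<Rightarrow> nat \<Rightarrow> complex \<Rightarrow> complex" where
  "carve A N z = of_real (1 - lens_depth A N (real N * Arg2pi z / (2 * pi))) * z"

text \<open>By periodicity this holds for every \<open>\<tau>\<close>, not only for the value in \<open>[0, N)\<close> that
  \<open>Arg2pi\<close> selects.\<close>
lemma carve_polar:
  assumes "N > 0" "r \<ge> 0"
  shows "carve A N (polar N r \<tau>) = polar N (r * (1 - lens_depth A N \<tau>)) \<tau>"
proof (cases "r = 0")
  case False
  with assms have r: "r > 0" by simp
  define m where "m = \<lfloor>\<tau> / real N\<rfloor>"
  define \<tau>' where "\<tau>' = \<tau> - of_int m * real N"
  have "of_int m \<le> \<tau> / real N" "\<tau> / real N < of_int m + 1"
    by (simp_all add: m_def)
  then have \<tau>': "0 \<le> \<tau>'" "\<tau>' < real N"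
    using assms by (simp_all add: \<tau>'_def field_simps)
  have \<tau>: "\<tau> = \<tau>' + of_int m * real N" by (simp add: \<tau>'_def)
  have "real N * Arg2pi (polar N r \<tau>') / (2 * pi) = \<tau>'"
    using assms r \<tau>' by (simp add: Arg2pi_polar)
  then show ?thesis
    unfolding \<tau> polar_add_period[OF assms(1)] lens_depth_add_period
    by (simp add: carve_def polar_def)
qed (simp add: carve_def polar_def)

text \<open>\<open>Arg2pi\<close> jumps at the positive real axis, so continuity is checked after pulling back along the
  polar parametrisation, which is a quotient map from a rectangle onto the disk.\<close>
lemma continuous_carve:
  assumes "N > 0"
  shows "continuous_on (cball 0 1) (carve A N)"
proof -
  define R where "R = {0..1::real} \<times> {0..real N}"
  define p where "p = (\<lambda>(r, \<tau>). polar N r \<tau>)"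
  have "p ` R = cball 0 1"
  proof
    show "p ` R \<subseteq> cball 0 1" by (auto simp: p_def R_def norm_polar)
    show "cball 0 1 \<subseteq> p ` R"
    proof
      fix z :: complex assume "z \<in> cball 0 1"
      then obtain r \<tau> where "0 \<le> r" "r \<le> 1" "0 \<le> \<tau>" "\<tau> < real N" "z = polar N r \<tau>"
        by (rule polar_cover[OF assms])
      then show "z \<in> p ` R" by (force simp: p_def R_def)
    qed
  qed
  moreover have "continuous_on R p"
    unfolding p_def polar_def split_beta using assms by (intro continuous_intros) auto
  moreover have "compact R"
    by (simp add: R_def compact_Times)
  ultimately have q: "quotient_map (top_of_set R) (top_of_set (cball 0 1)) p"
    by (intro T1_Spaces.continuous_imp_quotient_map) (auto simp: compact_space_subtopology Hausdorff_space_subtopology)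
  have "continuous_on R (\<lambda>x. polar N (fst x * (1 - lens_depth A N (snd x))) (snd x))"
    unfolding polar_def using assms
    by (intro continuous_intros continuous_on_compose2[OF continuous_lens_depth]) auto
  then have "continuous_on R (carve A N \<circ> p)"
    by (rule continuous_on_eq) (use assms in \<open>auto simp: p_def R_def carve_polar\<close>)
  then have "continuous_map (top_of_set R) euclidean (carve A N \<circ> p)"
    by simp
  with q have "continuous_map (top_of_set (cball 0 1)) euclidean (carve A N)"
    by (rule continuous_compose_quotient_map)
  then show ?thesis by simp
qed

text \<open>Maps the unit disk onto the lens at side \<open>i\<close>. The real part of a point \<open>z\<close> determines the
  parameter \<open>t\<close> on the side by \<open>Re z = - cos (\<pi> t)\<close>, and the vertical chord through \<open>z\<close>, of length
  \<open>2 sin (\<pi> t)\<close>, is mapped affinely onto the radial segment of the lens over \<open>t\<close>, of length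
  \<open>sin (\<pi> t) / 2\<close>. The lower end of the chord goes to the boundary of the polygon.\<close>
definition fill :: "nat \<Rightarrow> nat \<Rightarrow> complex \<Rightarrow> complex" where
  "fill N i z = polar N (1 - (Im z + sqrt (1 - (Re z)\<^sup>2)) / 4) (real i + 1 - arccos (Re z) / pi)"

lemma abs_Im_le_sqrt: "z \<in> cball 0 1 \<Longrightarrow> \<bar>Im z\<bar> \<le> sqrt (1 - (Re z)\<^sup>2)"
proof -
  assume "z \<in> cball 0 1"
  then have "(norm z)\<^sup>2 \<le> 1" by (simp add: abs_square_le_1)
  then show ?thesis
    by (intro real_le_rsqrt) (simp add: cmod_power2)
qed

lemma Re_bounds: "z \<in> cball 0 1 \<Longrightarrow> -1 \<le> Re z \<and> Re z \<le> 1"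
  using abs_Re_le_cmod[of z] by (simp add: abs_le_iff)

lemma continuous_fill:
  assumes "N > 0"
  shows "continuous_on (cball 0 1) (fill N i)"
  unfolding fill_def polar_def using assms Re_bounds by (intro continuous_intros ballI) auto

lemma sqrt_one_minus_cos: "0 \<le> t \<Longrightarrow> t \<le> 1 \<Longrightarrow> sqrt (1 - (cos (pi * t))\<^sup>2) = sin (pi * t)"
  by (simp add: sin_squared_eq[symmetric] sin_ge_zero)

text \<open>The boundary values of \<open>fill\<close>: the upper arc is side \<open>0\<close> of the bigon and lands on the inner
  boundary of the lens with the parameter reversed, as a gluing requires. On the lower arc, side \<open>1\<close>
  of the bigon, the image is the side of the polygon.\<close>
lemma fill_upper:
  assumes "0 \<le> t" "t \<le> 1"
  shows "fill N i (cis (pi * (1 - t))) = polar N (1 - sin (pi * t) / 2) (real i + t)"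
  using assms sqrt_one_minus_cos[OF assms]
  by (simp add: fill_def right_diff_distrib cos_diff sin_diff arccos_minus arccos_cos diff_divide_distrib)

lemma fill_lower:
  assumes "0 \<le> t" "t \<le> 1"
  shows "fill N i (cis (pi * (2 - t))) = polar N 1 (real i + (1 - t))"
proof -
  have *: "cos (pi * (2 - t)) = cos (pi * t)" "sin (pi * (2 - t)) = - sin (pi * t)"
    by (simp_all add: right_diff_distrib cos_diff sin_diff mult.commute[of pi])
  show ?thesis
    using assms sqrt_one_minus_cos[OF assms] unfolding fill_def cis.simps *
    by (simp add: arccos_cos algebra_simps)
qed

section \<open>Quotients and genus\<close>

text \<open>Both quotients are images of \<open>X\<close> under quotient maps with the same fibres.\<close>
lemma homeomorphic_quotient_topology:
  assumes h: "quotient_map X Y h"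
    and r: "equiv (topspace X) r" and r': "equiv (topspace Y) r'"
    and ker: "\<And>x y. x \<in> topspace X \<Longrightarrow> y \<in> topspace X \<Longrightarrow> (x, y) \<in> r \<longleftrightarrow> (h x, h y) \<in> r'"
  shows "quotient_topology X r homeomorphic_space quotient_topology Y r'"
proof -
  define F where "F = (\<lambda>C. r' `` (h ` C))"
  have hY: "h x \<in> topspace Y" if "x \<in> topspace X" for x
    using h that by (auto simp: quotient_map_def)
  have F: "F (r `` {x}) = r' `` {h x}" if x: "x \<in> topspace X" for x
  proof
    show "r' `` {h x} \<subseteq> F (r `` {x})"
      using equiv_class_self[OF r x] by (auto simp: F_def)
    show "F (r `` {x}) \<subseteq> r' `` {h x}"
    proof
      fix v assume "v \<in> F (r `` {x})"
      then obtain y where y: "(x, y) \<in> r" "(h y, v) \<in> r'" by (auto simp: F_def)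
      moreover have "y \<in> topspace X"
        using y(1) r x by (metis equiv_class_eq_iff)
      ultimately have "(h x, h y) \<in> r'"
        using ker x by blast
      then show "v \<in> r' `` {h x}"
        using y(2) r' by (meson Image_singleton_iff equiv_def transE)
    qed
  qed
  have "quotient_map X (quotient_topology Y r') ((\<lambda>y. r' `` {y}) \<circ> h)"
    using h quotient_map_quotient_topology by (rule quotient_map_compose)
  then have "quotient_map X (quotient_topology Y r') (F \<circ> (\<lambda>x. r `` {x}))"
    by (rule quotient_map_eq) (simp add: F)
  then have "quotient_map (quotient_topology X r) (quotient_topology Y r') F"
    by (simp only: quotient_map_compose_eq[OF quotient_map_quotient_topology])
  moreover have "inj_on F (topspace (quotient_topology X r))"
  proof (rule inj_onI)
    fix C D assume "C \<in> topspace (quotient_topology X r)" "D \<in> topspace (quotient_topology X r)"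
      and eq: "F C = F D"
    then obtain x y where xy: "x \<in> topspace X" "y \<in> topspace X" "C = r `` {x}" "D = r `` {y}"
      by (auto simp: quotient_def)
    then have "r' `` {h x} = r' `` {h y}" using eq F by simp
    then have "(h x, h y) \<in> r'"
      by (rule eq_equiv_class[OF _ r' hY[OF xy(2)]])
    then have "(x, y) \<in> r" using ker xy by blast
    then show "C = D" unfolding xy(3,4) by (rule equiv_class_eq[OF r])
  qed
  ultimately show ?thesis
    using homeomorphic_map_def homeomorphic_map_imp_homeomorphic_space by blast
qed

lemma nonseparating_curves_homeomorphic:
  assumes "S homeomorphic_space T" "nonseparating_curves S n"
  shows "nonseparating_curves T n"
proof -
  obtain h where h: "homeomorphic_map S T h"
    using assms(1) homeomorphic_space by blast
  then have inj: "inj_on h (topspace S)" and im: "h ` topspace S = topspace T"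
    using homeomorphic_imp_injective_map homeomorphic_imp_surjective_map by blast+
  obtain C where C: "\<And>i. i < n \<Longrightarrow> C i \<subseteq> topspace S"
      "\<And>i. i < n \<Longrightarrow> subtopology S (C i) homeomorphic_space top_of_set (sphere (0::complex) 1)"
      "disjoint_family_on C {..<n}"
      "connected_space (subtopology S (topspace S - (\<Union>i<n. C i)))"
    using assms(2) unfolding nonseparating_curves_def by blast
  have sub: "subtopology S U homeomorphic_space subtopology T (h ` U)" if "U \<subseteq> topspace S" for U
  proof -
    have "h ` (topspace S \<inter> U) = topspace T \<inter> h ` U" using that im by blast
    then show ?thesis
      by (rule homeomorphic_map_imp_homeomorphic_space[OF homeomorphic_map_subtopologies[OF h]])
  qed
  have "subtopology T (h ` C i) homeomorphic_space top_of_set (sphere (0::complex) 1)" if "i < n" for i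
    by (rule homeomorphic_space_trans
        [OF iffD1[OF homeomorphic_space_sym sub[OF C(1)[OF that]]] C(2)[OF that]])
  moreover have "disjoint_family_on (\<lambda>i. h ` C i) {..<n}"
    unfolding disjoint_family_on_def
  proof (intro ballI impI)
    fix i j assume ij: "i \<in> {..<n}" "j \<in> {..<n}" "i \<noteq> j"
    then have "h ` C i \<inter> h ` C j = h ` (C i \<inter> C j)"
      using C(1) by (intro inj_on_image_Int[OF inj, symmetric]) auto
    also have "C i \<inter> C j = {}"
      using C(3) ij by (auto simp: disjoint_family_on_def)
    finally show "h ` C i \<inter> h ` C j = {}" by simp
  qed
  moreover have "topspace T - (\<Union>i<n. h ` C i) = h ` (topspace S - (\<Union>i<n. C i))"
  proof -
    have "h ` (topspace S - (\<Union>i<n. C i)) = h ` topspace S - h ` (\<Union>i<n. C i)"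
      using C(1) by (intro inj_on_image_set_diff[OF inj]) auto
    then show ?thesis by (simp add: im image_UN)
  qed
  then have "connected_space (subtopology T (topspace T - (\<Union>i<n. h ` C i)))"
    using C(4) homeomorphic_connected_space[OF sub[of "topspace S - (\<Union>i<n. C i)"]] by auto
  moreover have "h ` C i \<subseteq> topspace T" if "i < n" for i
    using C(1)[OF that] im by blast
  ultimately show ?thesis
    unfolding nonseparating_curves_def by (intro exI[of _ "\<lambda>i. h ` C i"]) simp
qed

lemma has_genus_homeomorphic:
  assumes "S homeomorphic_space T"
  shows "has_genus S g \<longleftrightarrow> has_genus T g"
proof -
  have "nonseparating_curves S n \<longleftrightarrow> nonseparating_curves T n" for n
    using nonseparating_curves_homeomorphic[OF assms]
      nonseparating_curves_homeomorphic[OF iffD1[OF homeomorphic_space_sym assms]]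
    by blast
  then show ?thesis by (simp add: has_genus_def)
qed

lemma topspace_polygons: "topspace (polygons J) = J \<times> cball 0 1"
  by (simp add: polygons_def comp_def)

text \<open>A preimage of \<open>U\<close> is closed piece by piece; conversely \<open>U\<close> is the finite union of the images of
  these pieces, which are compact.\<close>
lemma quotient_map_polygons:
  assumes "finite J" and cont: "\<And>j. j \<in> J \<Longrightarrow> continuous_on (cball 0 1) (h j)"
    and im: "(\<Union>j\<in>J. h j ` cball 0 1) = cball 0 1"
  shows "quotient_map (polygons J) (polygons {m}) (\<lambda>(j, z). (m, h j z))"
  unfolding quotient_map_closedin
proof (intro conjI allI impI)
  let ?H = "\<lambda>(j, z). (m, h j z)"
  show "?H ` topspace (polygons J) = topspace (polygons {m})"
  proof -
    have "?H ` (J \<times> cball 0 1) = {m} \<times> (\<Union>j\<in>J. h j ` cball 0 1)" by auto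
    then show ?thesis by (simp only: topspace_polygons im)
  qed
  fix U assume U: "U \<subseteq> topspace (polygons {m})"
  define C where "C = {z. (m, z) \<in> U}"
  have CD: "C \<subseteq> cball 0 1"
    using U by (auto simp: C_def topspace_polygons)
  define B where "B = (\<lambda>j. {z \<in> cball 0 1. h j z \<in> C})"
  have "closedin (polygons J) {x \<in> topspace (polygons J). ?H x \<in> U} \<longleftrightarrow>
      (\<forall>j\<in>J. closedin (top_of_set (cball 0 1)) (B j))"
  proof -
    have "{x \<in> topspace (polygons J). ?H x \<in> U} = Sigma J B"
      by (auto simp: topspace_polygons B_def C_def)
    then show ?thesis by (simp only: polygons_def closedin_disjoint_union)
  qed
  also have "\<dots> \<longleftrightarrow> (\<forall>j\<in>J. closed (B j))"
    by (auto simp: closedin_closed_eq B_def)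
  also have "\<dots> \<longleftrightarrow> closed C"
  proof
    assume "\<forall>j\<in>J. closed (B j)"
    then have "compact (B j)" if "j \<in> J" for j
      using that by (metis (no_types, lifting) B_def bounded_cball bounded_subset compact_eq_bounded_closed mem_Collect_eq subsetI)
    moreover have BD: "B j \<subseteq> cball 0 1" for j
      unfolding B_def by blast
    ultimately have "compact (\<Union>j\<in>J. h j ` B j)"
      using assms(1) continuous_on_subset[OF cont BD]
      by (intro compact_UN compact_continuous_image)
    moreover have "(\<Union>j\<in>J. h j ` B j) = (\<Union>j\<in>J. h j ` cball 0 1) \<inter> C"
      unfolding B_def by blast
    ultimately show "closed C"
      using CD im by (simp add: compact_imp_closed Int_absorb1)
  next
    assume C: "closed C"
    have "B j = cball 0 1 \<inter> h j -` C" for j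
      by (auto simp: B_def)
    then show "\<forall>j\<in>J. closed (B j)"
      using continuous_closed_preimage[OF cont closed_cball C] by simp
  qed
  also have "\<dots> \<longleftrightarrow> closedin (polygons {m}) U"
  proof -
    have "U = Sigma {m} (\<lambda>_. C)"
      using U by (auto simp: C_def topspace_polygons)
    then have "closedin (polygons {m}) U \<longleftrightarrow> closedin (top_of_set (cball 0 1)) C"
      by (simp only: polygons_def closedin_disjoint_union) simp
    then show ?thesis using CD by (simp add: closedin_closed_eq)
  qed
  finally show "closedin (polygons J) {x \<in> topspace (polygons J). ?H x \<in> U} =
      closedin (polygons {m}) U" .
qed

lemma glued_surface_homeomorphic:
  assumes h: "quotient_map (polygons J) (polygons J') h"
    and ker: "\<And>x y. x \<in> topspace (polygons J) \<Longrightarrow> y \<in> topspace (polygons J) \<Longrightarrow>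
       equivclp (glue_points n G) x y \<longleftrightarrow> equivclp (glue_points n' G') (h x) (h y)"
  shows "glued_surface n J G homeomorphic_space glued_surface n' J' G'"
proof -
  have "equiv A {(x, y). x \<in> A \<and> y \<in> A \<and> equivclp R x y}" for A :: "'b set" and R
    by (intro equivI refl_onI symI transI) (auto intro: equivclp_sym equivclp_trans)
  moreover have "h x \<in> topspace (polygons J')" if "x \<in> topspace (polygons J)" for x
    using h that by (auto simp: quotient_map_def)
  ultimately show ?thesis
    unfolding glued_surface_def using h ker by (intro homeomorphic_quotient_topology) auto
qed

section \<open>Collapsing the bigons\<close>

text \<open>The gluing of the \<open>2k\<close>-gon, which is polygon \<open>0\<close>, to the bigons \<open>1, \<dots>, k\<close> along \<open>f\<close>.\<close>
locale bigon_gluing =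
  fixes k :: nat and n :: "nat \<Rightarrow> nat" and f :: "nat \<times> nat \<Rightarrow> nat \<times> nat"
  assumes k_pos: "k > 0"
    and n_def: "n = (\<lambda>j. if j = 0 then k * 2 else 2)"
    and f_bij: "bij_betw f (sides n {0}) (sides n {1..k})"
begin

abbreviation N :: nat where "N \<equiv> 2 * k"

text \<open>The sides of the \<open>2k\<close>-gon glued to the upper arc of a bigon. The lenses are placed here.\<close>
definition upper :: "nat set" where
  "upper = {i. i < N \<and> snd (f (0, i)) = 0}"

text \<open>The side of the \<open>2k\<close>-gon whose lens is filled by the bigon \<open>j\<close>.\<close>
definition base :: "nat \<Rightarrow> nat" where
  "base j = snd (the_inv_into (sides n {0}) f (j, 0))"

definition flatten :: "nat \<times> complex \<Rightarrow> nat \<times> complex" where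
  "flatten = (\<lambda>(j, z). (0, if j = 0 then carve upper N z else fill N (base j) z))"

abbreviation bigon_related :: "nat \<times> complex \<Rightarrow> nat \<times> complex \<Rightarrow> bool" where
  "bigon_related \<equiv> glue_points n {(s, f s) |s. s \<in> sides n {0}}"

abbreviation bigon_equiv :: "nat \<times> complex \<Rightarrow> nat \<times> complex \<Rightarrow> bool" where
  "bigon_equiv \<equiv> equivclp bigon_related"

abbreviation matching_pairs :: "((nat \<times> nat) \<times> (nat \<times> nat)) set" where
  "matching_pairs \<equiv> {(s, s'). s \<in> sides n {0} \<and> s' \<in> sides n {0} \<and> s \<noteq> s' \<and> fst (f s) = fst (f s')}"

abbreviation matching_related :: "nat \<times> complex \<Rightarrow> nat \<times> complex \<Rightarrow> bool" where
  "matching_related \<equiv> glue_points (\<lambda>_. N) matching_pairs"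

abbreviation matching_equiv :: "nat \<times> complex \<Rightarrow> nat \<times> complex \<Rightarrow> bool" where
  "matching_equiv \<equiv> equivclp matching_related"

lemma N_pos: "N > 0" using k_pos by simp

lemma in_sides_polygon [simp]: "(j, i) \<in> sides n {0} \<longleftrightarrow> j = 0 \<and> i < N"
  by (auto simp: sides_def n_def)

lemma in_sides_bigons: "(j, i) \<in> sides n {1..k} \<longleftrightarrow> 1 \<le> j \<and> j \<le> k \<and> i < 2"
  by (auto simp: sides_def n_def)

lemma f_cases:
  assumes "i < N"
  obtains j b where "f (0, i) = (j, b)" "1 \<le> j" "j \<le> k" "b = 0 \<or> b = 1"
proof -
  obtain j b where jb: "f (0, i) = (j, b)" by force
  have "f (0, i) \<in> sides n {1..k}"
    using bij_betw_apply[OF f_bij] assms by simp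
  then have "1 \<le> j" "j \<le> k" "b < 2" using jb in_sides_bigons by auto
  then show thesis using that jb by (auto simp: less_2_cases_iff)
qed

lemma f_inj: "i < N \<Longrightarrow> i' < N \<Longrightarrow> f (0, i) = f (0, i') \<Longrightarrow> i = i'"
  using bij_betw_imp_inj_on[OF f_bij] by (auto dest: inj_onD)

lemma base:
  assumes "1 \<le> j" "j \<le> k"
  shows "base j < N" "f (0, base j) = (j, 0)" "base j \<in> upper"
proof -
  have "(j, 0) \<in> sides n {1..k}" using assms in_sides_bigons by simp
  then have jf: "(j, 0) \<in> f ` sides n {0}"
    using f_bij by (simp add: bij_betw_def)
  let ?s = "the_inv_into (sides n {0}) f (j, 0)"
  have "?s \<in> sides n {0}" "f ?s = (j, 0)"
    using the_inv_into_into[OF bij_betw_imp_inj_on[OF f_bij] jf subset_refl]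
      f_the_inv_into_f[OF bij_betw_imp_inj_on[OF f_bij] jf] by simp_all
  then show "base j < N" "f (0, base j) = (j, 0)"
    by (cases ?s; simp add: base_def)+
  then show "base j \<in> upper" by (simp add: upper_def)
qed

lemma base_unique: "i < N \<Longrightarrow> f (0, i) = (j, 0) \<Longrightarrow> base j = i"
  by (rule f_cases[of i]) (auto intro: f_inj simp: base)

lemma side_point_polygon: "side_point n (0, i) t = (0, polar N 1 (real i + t))"
  by (simp add: side_point_def polar_def n_def)

lemma side_point_matching: "side_point (\<lambda>_. N) (j, i) t = (j, polar N 1 (real i + t))"
  by (simp add: side_point_def polar_def)

lemma side_point_bigon: "j \<ge> 1 \<Longrightarrow> side_point n (j, b) t = (j, cis (pi * (real b + t)))"
  by (simp add: side_point_def n_def)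

lemma bigon_relatedI:
  assumes "i < N" "f (0, i) = (j, b)" "1 \<le> j" "0 \<le> t" "t \<le> 1"
  shows "bigon_related (0, polar N 1 (real i + t)) (j, cis (pi * (real b + 1 - t)))"
  unfolding glue_points_def
  by (rule exI[of _ "(0, i)"], rule exI[of _ "(j, b)"], rule exI[of _ t])
     (use assms in \<open>auto simp: side_point_polygon side_point_bigon add_diff_eq\<close>)

lemma bigon_relatedE:
  assumes "bigon_related x y"
  obtains i j b t where "i < N" "f (0, i) = (j, b)" "1 \<le> j" "j \<le> k" "b = 0 \<or> b = 1" "0 \<le> t" "t \<le> 1"
    "x = (0, polar N 1 (real i + t))" "y = (j, cis (pi * (real b + 1 - t)))"
proof -
  from assms obtain s t where s: "s \<in> sides n {0}" "0 \<le> t" "t \<le> 1"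
      "x = side_point n s t" "y = side_point n (f s) (1 - t)"
    unfolding glue_points_def by auto
  then obtain i where i: "s = (0, i)" "i < N" by (cases s) auto
  obtain j b where jb: "f (0, i) = (j, b)" "1 \<le> j" "j \<le> k" "b = 0 \<or> b = 1"
    using f_cases[OF i(2)] .
  show thesis
    by (rule that[OF i(2) jb s(2,3)])
       (use s i jb in \<open>simp_all add: side_point_polygon side_point_bigon add_diff_eq\<close>)
qed

lemma matching_relatedI:
  assumes "i < N" "i' < N" "i \<noteq> i'" "fst (f (0, i)) = fst (f (0, i'))" "0 \<le> t" "t \<le> 1"
  shows "matching_related (0, polar N 1 (real i + t)) (0, polar N 1 (real i' + (1 - t)))"
  unfolding glue_points_def
  by (rule exI[of _ "(0, i)"], rule exI[of _ "(0, i')"], rule exI[of _ t])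
     (use assms in \<open>auto simp: side_point_matching\<close>)

lemma matching_relatedE:
  assumes "matching_related u v"
  obtains i i' t where "i < N" "i' < N" "i \<noteq> i'" "fst (f (0, i)) = fst (f (0, i'))" "0 \<le> t" "t \<le> 1"
    "u = (0, polar N 1 (real i + t))" "v = (0, polar N 1 (real i' + (1 - t)))"
proof -
  from assms obtain s s' t where s: "s \<in> sides n {0}" "s' \<in> sides n {0}" "s \<noteq> s'" "fst (f s) = fst (f s')"
      "0 \<le> t" "t \<le> 1" "u = side_point (\<lambda>_. N) s t" "v = side_point (\<lambda>_. N) s' (1 - t)"
    unfolding glue_points_def by auto
  moreover obtain i i' where i: "s = (0, i)" "i < N" "s' = (0, i')" "i' < N"
    using s(1,2) by (cases s; cases s') auto
  ultimately show thesis
    using that[of i i' t] by (auto simp: side_point_matching)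
qed

lemma flatten_polygon:
  assumes "i < N" "0 \<le> t" "t \<le> 1"
  shows "flatten (0, polar N 1 (real i + t)) =
    (0, polar N (if i \<in> upper then 1 - sin (pi * t) / 2 else 1) (real i + t))"
  using assms lens_depth_side[of i N t upper] carve_polar[OF N_pos, of 1 upper]
  by (simp add: flatten_def)

lemma flatten_upper:
  assumes "1 \<le> j" "j \<le> k" "0 \<le> t" "t \<le> 1"
  shows "flatten (j, cis (pi * (1 - t))) = flatten (0, polar N 1 (real (base j) + t))"
  unfolding flatten_polygon[OF base(1)[OF assms(1,2)] assms(3,4)]
  using assms base by (simp add: flatten_def fill_upper)

lemma flatten_lower:
  assumes "1 \<le> j" "0 \<le> t" "t \<le> 1"
  shows "flatten (j, cis (pi * (2 - t))) = (0, polar N 1 (real (base j) + (1 - t)))"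
  using assms by (simp add: flatten_def fill_lower)

text \<open>A gluing along the upper arc of a bigon becomes an equality, since the shrunken side and the inner
  boundary of the lens coincide. A gluing along the lower arc becomes a gluing of the
  matching, since that arc is mapped onto the partner side.\<close>
lemma bigon_related_imp_matching_equiv:
  assumes "bigon_related x y"
  shows "matching_equiv (flatten x) (flatten y)"
proof -
  obtain i j b t where *: "i < N" "f (0, i) = (j, b)" "1 \<le> j" "j \<le> k" "b = 0 \<or> b = 1" "0 \<le> t" "t \<le> 1"
    "x = (0, polar N 1 (real i + t))" "y = (j, cis (pi * (real b + 1 - t)))"
    using assms by (rule bigon_relatedE)
  note bj = base[OF *(3,4)]
  show ?thesis
  proof (cases "b = 0")
    case True
    then have "base j = i" using base_unique * by simp
    then have "flatten y = flatten x"
      using flatten_upper[OF *(3,4,6,7)] True * by simp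
    then show ?thesis by simp
  next
    case False
    then have b: "b = 1" using * by simp
    then have "i \<notin> upper" "i \<noteq> base j" using * bj by (auto simp: upper_def)
    moreover have "real b + 1 - t = 2 - t" using b by simp
    ultimately have "matching_related (flatten x) (flatten y)"
      unfolding *(8,9) flatten_polygon[OF *(1,6,7)]
      using flatten_lower[OF *(3,6,7)] matching_relatedI[of i "base j" t] * bj by simp
    then show ?thesis by blast
  qed
qed

lemma bigon_equiv_imp_matching_equiv:
  assumes "bigon_equiv x y"
  shows "matching_equiv (flatten x) (flatten y)"
  using assms
proof (induction rule: equivclp_induct)
  case (step y z)
  from step(2) have "matching_equiv (flatten y) (flatten z)"
    by (auto intro: bigon_related_imp_matching_equiv equivclp_sym[OF bigon_related_imp_matching_equiv])
  with step.IH show ?case by (rule equivclp_trans)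
qed simp

abbreviation pieces :: "(nat \<times> complex) set" where
  "pieces \<equiv> topspace (polygons {0..k})"

text \<open>The upper arcs are the part of the bigons on which \<open>flatten\<close> takes values that it also takes on
  the \<open>2k\<close>-gon.\<close>
definition on_upper_arc :: "nat \<times> complex \<Rightarrow> bool" where
  "on_upper_arc = (\<lambda>(j, z). j \<noteq> 0 \<and> Im z = sqrt (1 - (Re z)\<^sup>2))"

text \<open>A point on an upper arc is glued to a point of the \<open>2k\<close>-gon. This includes both corners of a
  bigon, so the bigon points left over are mapped to angles strictly inside one side.\<close>
lemma move_off_upper_arc:
  assumes "x \<in> pieces"
  obtains y where "y \<in> pieces" "\<not> on_upper_arc y" "bigon_equiv x y" "flatten y = flatten x"
proof (cases "on_upper_arc x")
  case True
  then obtain j z where x: "x = (j, z)" "1 \<le> j" "j \<le> k" "z \<in> cball 0 1" "Im z = sqrt (1 - (Re z)\<^sup>2)"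
    using assms by (cases x) (auto simp: on_upper_arc_def topspace_polygons)
  define t where "t = 1 - arccos (Re z) / pi"
  have re: "-1 \<le> Re z" "Re z \<le> 1" using Re_bounds[OF x(4)] by auto
  then have t: "0 \<le> t" "t \<le> 1"
    using arccos_lbound[of "Re z"] arccos_ubound[of "Re z"] by (auto simp: t_def)
  have a: "pi * (1 - t) = arccos (Re z)" by (simp add: t_def)
  have z: "z = cis (pi * (1 - t))"
    unfolding a using x(5) re by (intro complex_eqI) (simp_all add: sin_arccos)
  note bj = base[OF x(2,3)]
  let ?y = "(0, polar N 1 (real (base j) + t))"
  have "bigon_related ?y x"
    using bigon_relatedI[OF bj(1,2) x(2) t] by (simp add: x(1) z)
  then have "bigon_equiv x ?y" by blast
  moreover have "flatten ?y = flatten x"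
    using flatten_upper[OF x(2,3) t] by (simp add: x(1) z)
  ultimately show thesis
    by (intro that[of ?y]) (auto simp: on_upper_arc_def topspace_polygons norm_polar)
qed (use assms that in auto)

lemma fill_polar_coordinates:
  assumes "1 \<le> j" "j \<le> k" "z \<in> cball 0 1" "\<not> on_upper_arc (j, z)"
  obtains r t where "fill N (base j) z = polar N r (real (base j) + t)" "0 < t" "t < 1"
    "1 - sin (pi * t) / 2 < r" "r \<le> 1" "Re z = - cos (pi * t)" "Im z = 4 * (1 - r) - sin (pi * t)"
proof
  define t where "t = 1 - arccos (Re z) / pi"
  define r where "r = 1 - (Im z + sqrt (1 - (Re z)\<^sup>2)) / 4"
  have "Im z < sqrt (1 - (Re z)\<^sup>2)"
    using abs_Im_le_sqrt[OF assms(3)] assms(1,4) by (auto simp: on_upper_arc_def abs_le_iff)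
  moreover have "- sqrt (1 - (Re z)\<^sup>2) \<le> Im z" using abs_Im_le_sqrt[OF assms(3)] by linarith
  ultimately have im: "- sqrt (1 - (Re z)\<^sup>2) \<le> Im z" "Im z < sqrt (1 - (Re z)\<^sup>2)"
    "0 < sqrt (1 - (Re z)\<^sup>2)" by linarith+
  have re: "-1 \<le> Re z" "Re z \<le> 1" using Re_bounds[OF assms(3)] by auto
  moreover have "Re z \<noteq> 1" "Re z \<noteq> -1" using im(3) by auto
  ultimately have re': "-1 < Re z" "Re z < 1" by auto
  then show "0 < t" "t < 1"
    using arccos_lt_bounded[OF re'] by (auto simp: t_def)
  have a: "pi * t = pi - arccos (Re z)" by (simp add: t_def right_diff_distrib)
  have s: "sin (pi * t) = sqrt (1 - (Re z)\<^sup>2)" unfolding a using re by (simp add: sin_arccos)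
  show "Re z = - cos (pi * t)" unfolding a using re by (simp add: cos_arccos)
  show "1 - sin (pi * t) / 2 < r" "r \<le> 1" "Im z = 4 * (1 - r) - sin (pi * t)"
    using im by (simp_all add: s r_def add_divide_distrib)
  show "fill N (base j) z = polar N r (real (base j) + t)"
    by (simp add: fill_def r_def t_def add_diff_eq)
qed

lemma carve_inj: "inj_on (carve upper N) (cball 0 1)"
proof (rule inj_onI)
  fix z w :: complex assume "z \<in> cball 0 1" "w \<in> cball 0 1" and eq: "carve upper N z = carve upper N w"
  then obtain r \<tau> r' \<tau>' where z: "0 \<le> r" "0 \<le> \<tau>" "\<tau> < real N" "z = polar N r \<tau>"
    and w: "0 \<le> r'" "0 \<le> \<tau>'" "\<tau>' < real N" "w = polar N r' \<tau>'"
    using polar_cover[OF N_pos] by metis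
  define a where "a = 1 - lens_depth upper N \<tau>"
  define b where "b = 1 - lens_depth upper N \<tau>'"
  have ab: "a > 0" "b > 0"
    using lens_depth_bounds(2)[of upper N \<tau>] lens_depth_bounds(2)[of upper N \<tau>']
    by (simp_all add: a_def b_def)
  have eq': "polar N (r * a) \<tau> = polar N (r' * b) \<tau>'"
    using eq z w by (simp add: carve_polar[OF N_pos] a_def b_def)
  have "norm (polar N (r * a) \<tau>) = norm (polar N (r' * b) \<tau>')"
    by (simp only: eq')
  then have "r * a = r' * b"
    using z(1) w(1) ab by (simp add: norm_polar abs_mult)
  show "z = w"
  proof (cases "r = 0")
    case True
    then have "r' = 0" using \<open>r * a = r' * b\<close> ab by simp
    with True show ?thesis using z w by (simp add: polar_def)
  next
    case False
    then have "r * a > 0" using z(1) ab by simp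
    moreover from this have "r' * b > 0" using \<open>r * a = r' * b\<close> by simp
    ultimately have "\<tau> = \<tau>'"
      using eq' polar_eq_polar_iff[OF N_pos _ z(2,3) _ w(2,3), of "r * a" "r' * b"] by blast
    then show ?thesis using \<open>r * a = r' * b\<close> ab z w by (simp add: a_def b_def)
  qed
qed

text \<open>Off the upper arc, \<open>fill\<close> gives a radius larger than the one at which \<open>carve\<close> stops in the same
  direction.\<close>
lemma carve_neq_fill:
  assumes "z \<in> cball 0 1" "1 \<le> j" "j \<le> k" "w \<in> cball 0 1" "\<not> on_upper_arc (j, w)"
  shows "carve upper N z \<noteq> fill N (base j) w"
proof
  assume eq: "carve upper N z = fill N (base j) w"
  obtain r \<tau> where z: "0 \<le> r" "r \<le> 1" "0 \<le> \<tau>" "\<tau> < real N" "z = polar N r \<tau>"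
    using polar_cover[OF N_pos assms(1)] .
  obtain r' t where w: "fill N (base j) w = polar N r' (real (base j) + t)" "0 < t" "t < 1"
    "1 - sin (pi * t) / 2 < r'"
    using fill_polar_coordinates[OF assms(2-)] .
  note bj = base[OF assms(2,3)]
  have r': "r' > 0" using w(4) sin_le_one[of "pi * t"] by linarith
  have eq': "polar N (r * (1 - lens_depth upper N \<tau>)) \<tau> = polar N r' (real (base j) + t)"
    using eq z w by (simp add: carve_polar[OF N_pos])
  have d: "1 - lens_depth upper N \<tau> > 0"
    using lens_depth_bounds(2)[of upper N \<tau>] by linarith
  have "r * (1 - lens_depth upper N \<tau>) = r'"
    using arg_cong[OF eq', of norm] z d r' by (simp add: norm_polar abs_mult)
  moreover have "real (base j) + t < real N" using bj(1) w(3) by linarith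
  ultimately have "\<tau> = real (base j) + t"
    using eq' z r' w(2) polar_eq_polar_iff[OF N_pos, of r' \<tau> r' "real (base j) + t"] by simp
  then have "lens_depth upper N \<tau> = sin (pi * t) / 2"
    using lens_depth_side[OF bj(1), of t upper] w bj(3) by simp
  moreover have "r * (1 - lens_depth upper N \<tau>) \<le> 1 - lens_depth upper N \<tau>"
    using z d by (simp add: mult_left_le_one_le)
  ultimately show False
    using \<open>r * (1 - lens_depth upper N \<tau>) = r'\<close> w(4) by simp
qed

text \<open>The angle lies strictly inside a side and so determines the side, hence the bigon, and
  the real part; the radius then gives the imaginary part.\<close>
lemma fill_inj:
  assumes "1 \<le> j" "j \<le> k" "z \<in> cball 0 1" "\<not> on_upper_arc (j, z)"
    "1 \<le> j'" "j' \<le> k" "w \<in> cball 0 1" "\<not> on_upper_arc (j', w)"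
    and eq: "fill N (base j) z = fill N (base j') w"
  shows "(j, z) = (j', w)"
proof -
  obtain r t where z: "fill N (base j) z = polar N r (real (base j) + t)" "0 < t" "t < 1"
    "1 - sin (pi * t) / 2 < r" "Re z = - cos (pi * t)" "Im z = 4 * (1 - r) - sin (pi * t)"
    using fill_polar_coordinates[OF assms(1-4)] .
  obtain r' t' where w: "fill N (base j') w = polar N r' (real (base j') + t')" "0 < t'" "t' < 1"
    "1 - sin (pi * t') / 2 < r'" "Re w = - cos (pi * t')" "Im w = 4 * (1 - r') - sin (pi * t')"
    using fill_polar_coordinates[OF assms(5-8)] .
  note bj = base[OF assms(1,2)] base[OF assms(5,6)]
  have "r > 0" "r' > 0"
    using z(4) w(4) sin_le_one[of "pi * t"] sin_le_one[of "pi * t'"] by linarith+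
  moreover have "real (base j) + t < real N" "real (base j') + t' < real N"
    using bj(1,4) z(3) w(3) by linarith+
  ultimately have *: "r = r'" "real (base j) + t = real (base j') + t'"
    using eq z w polar_eq_polar_iff[OF N_pos, of r "real (base j) + t" r' "real (base j') + t'"]
    by auto
  then have b: "base j = base j'" using z(2,3) w(2,3) by linarith
  then have "t = t'" using * by simp
  then have "z = w" using * z w by (intro complex_eqI) auto
  moreover have "(j, 0::nat) = (j', 0)" by (simp only: bj(2)[symmetric] bj(5)[symmetric] b)
  ultimately show ?thesis by simp
qed

text \<open>Once all points are moved off the upper arcs, \<open>flatten\<close> is injective.\<close>
lemma flatten_eq_imp_bigon_equiv:
  assumes "x \<in> pieces" "y \<in> pieces" "flatten x = flatten y"
  shows "bigon_equiv x y"
proof -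
  obtain x' where x': "x' \<in> pieces" "\<not> on_upper_arc x'" "bigon_equiv x x'" "flatten x' = flatten x"
    using move_off_upper_arc[OF assms(1)] .
  obtain y' where y': "y' \<in> pieces" "\<not> on_upper_arc y'" "bigon_equiv y y'" "flatten y' = flatten y"
    using move_off_upper_arc[OF assms(2)] .
  obtain j z j' w where jz: "x' = (j, z)" "y' = (j', w)" using prod.exhaust by metis
  have c: "j \<le> k" "z \<in> cball 0 1" "j' \<le> k" "w \<in> cball 0 1"
    using x'(1) y'(1) by (auto simp: jz topspace_polygons)
  have "flatten (j, z) = flatten (j', w)"
    using x'(4) y'(4) assms(3) jz by simp
  then have eq: "(if j = 0 then carve upper N z else fill N (base j) z) =
      (if j' = 0 then carve upper N w else fill N (base j') w)"
    by (simp add: flatten_def)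
  have "(j, z) = (j', w)"
  proof (cases "j = 0"; cases "j' = 0")
    assume "j = 0" "j' = 0"
    then show ?thesis using eq c inj_onD[OF carve_inj] by simp
  next
    assume "j = 0" "j' \<noteq> 0"
    then show ?thesis using eq c carve_neq_fill[of z j' w] y'(2) jz by simp
  next
    assume "j \<noteq> 0" "j' = 0"
    then show ?thesis using eq c carve_neq_fill[of w j z] x'(2) jz by simp
  next
    assume "j \<noteq> 0" "j' \<noteq> 0"
    then show ?thesis using eq c fill_inj[of j z j' w] x'(2) y'(2) jz by simp
  qed
  then have "x' = y'" by (simp only: jz)
  then have "bigon_equiv x' y" using equivclp_sym[OF y'(3)] by (simp only:)
  then show ?thesis by (rule equivclp_trans[OF x'(3)])
qed

text \<open>Of two partner sides one is glued to the upper and one to the lower arc of their bigon. The lower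
  arc represents the side at the lens, and the other side, which carries no lens, is fixed by
  \<open>flatten\<close>; these two are glued directly.\<close>
lemma matching_related_lift:
  assumes "matching_related u v"
  obtains x y where "x \<in> pieces" "y \<in> pieces" "flatten x = u" "flatten y = v" "bigon_equiv x y"
proof -
  have lift: "\<exists>x\<in>pieces. \<exists>y\<in>pieces. flatten x = (0, polar N 1 (real i + t)) \<and>
      flatten y = (0, polar N 1 (real i' + (1 - t))) \<and> bigon_equiv x y"
    if "i' < N" "f (0, i) = (j, 0)" "f (0, i') = (j, 1)" "i < N" "1 \<le> j" "j \<le> k" "0 \<le> t" "t \<le> 1"
    for i i' j t
  proof (intro bexI conjI)
    let ?x = "(j, cis (pi * (2 - (1 - t))))" and ?y = "(0::nat, polar N 1 (real i' + (1 - t)))"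
    have "base j = i" using base_unique that by simp
    then show "flatten ?x = (0, polar N 1 (real i + t))"
      using flatten_lower[of j "1 - t"] that by simp
    have "i' \<notin> upper" using that by (simp add: upper_def)
    then show "flatten ?y = (0, polar N 1 (real i' + (1 - t)))"
      using flatten_polygon[of i' "1 - t"] that by simp
    have "bigon_related ?y ?x"
      using bigon_relatedI[of i' j 1 "1 - t"] that by simp
    then show "bigon_equiv ?x ?y" by blast
    show "?x \<in> pieces" "?y \<in> pieces"
      using that by (auto simp: topspace_polygons norm_polar)
  qed
  obtain i i' t where *: "i < N" "i' < N" "i \<noteq> i'" "fst (f (0, i)) = fst (f (0, i'))" "0 \<le> t" "t \<le> 1"
    "u = (0, polar N 1 (real i + t))" "v = (0, polar N 1 (real i' + (1 - t)))"
    using assms by (rule matching_relatedE)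
  obtain j b where j: "f (0, i) = (j, b)" "1 \<le> j" "j \<le> k" "b = 0 \<or> b = 1"
    using f_cases[OF *(1)] .
  obtain j' b' where j': "f (0, i') = (j', b')" "b' = 0 \<or> b' = 1"
    using f_cases[OF *(2)] .
  have jj: "j' = j" "b \<noteq> b'" using * j j' f_inj[of i i'] by auto
  show thesis
  proof (cases "b = 0")
    case True
    then have "f (0, i) = (j, 0)" "f (0, i') = (j, 1)" using j(1) j' jj by auto
    from lift[OF *(2) this *(1) j(2,3) *(5,6)] show thesis
      unfolding *(7,8)[symmetric] using that by blast
  next
    case False
    then have flip: "f (0, i') = (j, 0)" "f (0, i) = (j, 1)" using j(1,4) j' jj by auto
    have t: "0 \<le> 1 - t" "1 - t \<le> 1" "1 - (1 - t) = t" using *(5,6) by auto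
    from lift[OF *(1) flip *(2) j(2,3) t(1,2)]
    obtain y x where xy: "y \<in> pieces" "x \<in> pieces" "flatten y = v" "flatten x = u" "bigon_equiv y x"
      unfolding t(3) *(7,8)[symmetric] by blast
    show thesis
      by (rule that[OF xy(2,1,4,3) equivclp_sym[OF xy(5)]])
  qed
qed

text \<open>A chain of gluings of the matching lifts step by step; consecutive lifts meet in points with the
  same image, which are equivalent by \<open>flatten_eq_imp_bigon_equiv\<close>.\<close>
lemma matching_equiv_imp_bigon_equiv:
  assumes "matching_equiv u v" "x \<in> pieces" "y \<in> pieces" "flatten x = u" "flatten y = v"
  shows "bigon_equiv x y"
  using assms(1,3,5)
proof (induction arbitrary: y rule: equivclp_induct)
  case base
  then show ?case using assms flatten_eq_imp_bigon_equiv by simp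
next
  case (step v w)
  obtain x' y' where *: "x' \<in> pieces" "y' \<in> pieces" "flatten x' = v" "flatten y' = w" "bigon_equiv x' y'"
    using step(2)
  proof
    assume "matching_related v w"
    then show thesis by (rule matching_related_lift) (rule that)
  next
    assume "matching_related w v"
    then obtain y' x' where "y' \<in> pieces" "x' \<in> pieces" "flatten y' = w" "flatten x' = v" "bigon_equiv y' x'"
      by (rule matching_related_lift)
    then show thesis by (intro that[of x' y']) (simp_all only: equivclp_sym[of _ y' x'])
  qed
  have "bigon_equiv x x'" using step.IH[OF *(1,3)] .
  also note *(5)
  also have "bigon_equiv y' y"
    using flatten_eq_imp_bigon_equiv[OF *(2) step.prems(1)] *(4) step.prems(2) by simp
  finally show ?case .
qed

text \<open>In a given direction \<open>\<tau>\<close>, the radii up to \<open>1 - lens_depth\<close> are reached by \<open>carve\<close> and the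
  remaining ones by filling the lens.\<close>
lemma flatten_surj: "(\<Union>j\<in>{0..k}. (if j = 0 then carve upper N else fill N (base j)) ` cball 0 1) = cball 0 1"
  (is "(\<Union>j\<in>_. ?h j ` _) = _")
proof (intro equalityI subsetI)
  fix u assume "u \<in> (\<Union>j\<in>{0..k}. ?h j ` cball 0 1)"
  then obtain j z where jz: "j \<le> k" "z \<in> cball 0 1" "u = ?h j z" by auto
  show "u \<in> cball 0 1"
  proof (cases "j = 0")
    case True
    obtain r \<tau> where z: "0 \<le> r" "r \<le> 1" "z = polar N r \<tau>"
      using polar_cover[OF N_pos jz(2)] .
    have "0 \<le> 1 - lens_depth upper N \<tau>" "1 - lens_depth upper N \<tau> \<le> 1"
      using lens_depth_bounds[of upper N \<tau>] by linarith+
    then have "\<bar>r * (1 - lens_depth upper N \<tau>)\<bar> \<le> 1"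
      using z(1,2) by (simp add: abs_mult mult_le_one)
    moreover have "u = polar N (r * (1 - lens_depth upper N \<tau>)) \<tau>"
      using True jz(3) z(3) carve_polar[OF N_pos z(1)] by simp
    ultimately show ?thesis by (simp only: mem_cball dist_0_norm norm_polar)
  next
    case False
    have "\<bar>1 - (a + b) / 4\<bar> \<le> 1" if "\<bar>a\<bar> \<le> b" "b \<le> 1" for a b :: real
      using that by (simp add: abs_le_iff)
    from this[OF abs_Im_le_sqrt[OF jz(2)]]
    have "\<bar>1 - (Im z + sqrt (1 - (Re z)\<^sup>2)) / 4\<bar> \<le> 1" by simp
    moreover have "u = fill N (base j) z" using jz(3) unfolding if_not_P[OF False] .
    ultimately show ?thesis by (simp only: fill_def mem_cball dist_0_norm norm_polar)
  qed
next
  fix u :: complex assume "u \<in> cball 0 1"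
  then obtain r \<tau> where u: "0 \<le> r" "r \<le> 1" "0 \<le> \<tau>" "\<tau> < real N" "u = polar N r \<tau>"
    by (rule polar_cover[OF N_pos])
  define d where "d = lens_depth upper N \<tau>"
  have d: "0 \<le> d" "d \<le> 1/2" unfolding d_def by (rule lens_depth_bounds)+
  show "u \<in> (\<Union>j\<in>{0..k}. ?h j ` cball 0 1)"
  proof (cases "r \<le> 1 - d")
    case True
    have r: "0 \<le> r / (1 - d)" "r / (1 - d) \<le> 1" "r / (1 - d) * (1 - d) = r"
      using True u(1) d by simp_all
    have "carve upper N (polar N (r / (1 - d)) \<tau>) = polar N (r / (1 - d) * (1 - d)) \<tau>"
      using carve_polar[OF N_pos r(1)] unfolding d_def .
    then have "?h 0 (polar N (r / (1 - d)) \<tau>) = u" by (simp only: r(3) u(5) if_True refl)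
    moreover have "polar N (r / (1 - d)) \<tau> \<in> cball 0 1"
      using r(1,2) by (simp only: mem_cball dist_0_norm norm_polar abs_of_nonneg)
    ultimately show ?thesis by (intro UN_I[of 0] image_eqI[OF sym]) simp_all
  next
    case False
    define i where "i = nat \<lfloor>\<tau>\<rfloor>"
    define t where "t = \<tau> - real i"
    have "real i = of_int \<lfloor>\<tau>\<rfloor>" using u by (simp add: i_def)
    then have i: "real i \<le> \<tau>" "\<tau> < real i + 1" by linarith+
    then have iN: "i < N" using u(4) by linarith
    have t: "0 \<le> t" "t \<le> 1" "\<tau> = real i + t" using i by (auto simp: t_def)
    have dd: "d = (if i \<in> upper then sin (pi * t) / 2 else 0)"
      unfolding d_def t(3) using lens_depth_side[OF iN t(1,2)] .
    then have iu: "i \<in> upper" "d = sin (pi * t) / 2"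
      using False u by (auto split: if_splits)
    obtain j where j: "f (0, i) = (j, 0)" "1 \<le> j" "j \<le> k"
      by (rule f_cases[OF iN]) (use iu in \<open>auto simp: upper_def\<close>)
    then have b: "base j = i" using base_unique iN by simp
    \<comment> \<open>The point of the chord over \<open>t\<close> that \<open>fill\<close> sends to radius \<open>r\<close>.\<close>
    define w where "w = Complex (- cos (pi * t)) (4 * (1 - r) - sin (pi * t))"
    have "\<bar>Im w\<bar> \<le> \<bar>sin (pi * t)\<bar>"
      using False iu u d by (auto simp: w_def abs_le_iff)
    then have "(Im w)\<^sup>2 \<le> (sin (pi * t))\<^sup>2" by (rule abs_le_square_iff[THEN iffD1])
    moreover have "(norm w)\<^sup>2 = (cos (pi * t))\<^sup>2 + (Im w)\<^sup>2"
      by (simp add: cmod_power2 w_def)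
    ultimately have "(norm w)\<^sup>2 \<le> 1"
      using sin_cos_squared_add2[of "pi * t"] by linarith
    then have "w \<in> cball 0 1" by (simp add: abs_square_le_1)
    have fu: "fill N (base j) w = u"
    proof -
      have "arccos (- cos (pi * t)) = pi - pi * t"
        using t by (simp add: arccos_minus arccos_cos)
      moreover have "(pi - pi * t) / pi = 1 - t" by (simp add: diff_divide_distrib)
      moreover have "sqrt (1 - (Re w)\<^sup>2) = sin (pi * t)"
        using sqrt_one_minus_cos[OF t(1,2)] by (simp add: w_def)
      ultimately have "fill N (base j) w = polar N (1 - (Im w + sin (pi * t)) / 4) (real i + 1 - (1 - t))"
        by (simp add: fill_def w_def b)
      also have "1 - (Im w + sin (pi * t)) / 4 = r" by (simp add: w_def field_simps)
      also have "real i + 1 - (1 - t) = \<tau>" by (simp add: t(3))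
      finally show ?thesis by (simp only: u(5))
    qed
    have "j \<noteq> 0" using j(2) by simp
    have "?h j w = u" unfolding if_not_P[OF \<open>j \<noteq> 0\<close>] by (rule fu)
    with \<open>w \<in> cball 0 1\<close> show ?thesis using j(3) by (intro UN_I[of j] image_eqI[OF sym]) simp_all
  qed
qed

lemma glued_bigons_homeomorphic:
  "glued_surface n {0..k} {(s, f s) |s. s \<in> sides n {0}} homeomorphic_space
   glued_surface (\<lambda>_. N) {0} matching_pairs"
proof (rule glued_surface_homeomorphic)
  let ?h = "\<lambda>j. if j = 0 then carve upper N else fill N (base j)"
  have "quotient_map (polygons {0..k}) (polygons {0}) (\<lambda>(j, z). (0, ?h j z))"
    using continuous_carve[OF N_pos] continuous_fill[OF N_pos] flatten_surj
    by (intro quotient_map_polygons) auto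
  moreover have "(\<lambda>(j, z). (0, ?h j z)) = flatten"
    by (auto simp: flatten_def fun_eq_iff)
  ultimately show "quotient_map (polygons {0..k}) (polygons {0}) flatten" by simp
  show "bigon_equiv x y \<longleftrightarrow> matching_equiv (flatten x) (flatten y)"
    if "x \<in> pieces" "y \<in> pieces" for x y
    by (rule iffI[OF bigon_equiv_imp_matching_equiv
      matching_equiv_imp_bigon_equiv[OF _ that refl refl]])
qed

end

section \<open>Counting the bijections that induce a given matching\<close>

definition fibre_matching :: "'a set \<Rightarrow> 'b set \<Rightarrow> ('a \<Rightarrow> 'b \<times> nat) \<Rightarrow> 'a set set" where
  "fibre_matching S J f = (\<lambda>j. {s \<in> S. fst (f s) = j}) ` J"

lemma card_fibre:
  assumes f: "bij_betw f S (J \<times> {..<2::nat})" and j: "j \<in> J"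
  shows "card {s \<in> S. fst (f s) = j} = 2"
proof -
  let ?F = "{s \<in> S. fst (f s) = j}"
  have image: "f ` ?F = {j} \<times> {..<2}"
  proof
    show "f ` ?F \<subseteq> {j} \<times> {..<2}"
      using bij_betw_apply[OF f] by fastforce
    show "{j} \<times> {..<2} \<subseteq> f ` ?F"
    proof
      fix p assume p: "p \<in> {j} \<times> {..<2::nat}"
      moreover have "f ` S = J \<times> {..<2}" using f by (simp add: bij_betw_def)
      ultimately obtain s where "s \<in> S" "f s = p" using j by (metis SigmaE SigmaI imageE singletonD)
      then show "p \<in> f ` ?F" using p by (intro image_eqI[of _ _ s]) auto
    qed
  qed
  have "inj_on f ?F"
    using bij_betw_imp_inj_on[OF f] by (rule inj_on_subset) auto
  from card_image[OF this] show ?thesis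
    unfolding image by (simp add: card_cartesian_product)
qed

lemma fibre_matching_perfect:
  assumes f: "bij_betw f S (J \<times> {..<2::nat})"
  shows "fibre_matching S J f \<in> perfect_matchings S"
proof -
  have "fst (f s) \<in> J" if "s \<in> S" for s
    using bij_betw_apply[OF f that] by auto
  moreover have "{s \<in> S. fst (f s) = j} \<noteq> {}" if "j \<in> J" for j
    using card_fibre[OF f that] by (metis card.empty zero_neq_numeral)
  ultimately have "partition_on S (fibre_matching S J f)"
    unfolding fibre_matching_def by (intro partition_onI) (auto simp: disjnt_def)
  then show ?thesis
    using card_fibre[OF f] by (auto simp: perfect_matchings_def fibre_matching_def)
qed

lemma pair_in_fibre_matching:
  assumes f: "bij_betw f S (J \<times> {..<2::nat})"
  shows "{s, s'} \<in> fibre_matching S J f \<longleftrightarrow> s \<in> S \<and> s' \<in> S \<and> s \<noteq> s' \<and> fst (f s) = fst (f s')"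
proof
  assume "{s, s'} \<in> fibre_matching S J f"
  then obtain j where j: "j \<in> J" "{s, s'} = {s \<in> S. fst (f s) = j}"
    by (auto simp: fibre_matching_def)
  then have "card {s, s'} = 2" using card_fibre[OF f] by simp
  then have "s \<noteq> s'" by auto
  moreover have "s \<in> {s \<in> S. fst (f s) = j}" "s' \<in> {s \<in> S. fst (f s) = j}"
    unfolding j(2)[symmetric] by auto
  ultimately show "s \<in> S \<and> s' \<in> S \<and> s \<noteq> s' \<and> fst (f s) = fst (f s')" by simp
next
  assume s: "s \<in> S \<and> s' \<in> S \<and> s \<noteq> s' \<and> fst (f s) = fst (f s')"
  let ?F = "{t \<in> S. fst (f t) = fst (f s)}"
  have "fst (f s) \<in> J" using bij_betw_apply[OF f, of s] s by auto
  moreover from this have "card ?F = 2" by (rule card_fibre[OF f])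
  then have "{s, s'} = ?F"
    using s by (intro card_subset_eq) (auto intro: card_ge_0_finite)
  ultimately show "{s, s'} \<in> fibre_matching S J f"
    by (auto simp: fibre_matching_def)
qed

text \<open>Such an \<open>f\<close> amounts to a bijection \<open>\<sigma>\<close> from the bigons to the pairs of \<open>P\<close> together with a choice
  \<open>c\<close> of the element of each pair that goes to side \<open>0\<close>: there are \<open>(card J)!\<close> bijections and
  \<open>2 ^ card J\<close> choices for each of them.\<close>
lemma card_bijections_with_fibre_matching:
  fixes S :: "'a set" and J :: "'b set"
  assumes fin: "finite S" "finite J" and P: "P \<in> perfect_matchings S" and card: "card S = 2 * card J"
  shows "card {f \<in> S \<rightarrow>\<^sub>E J \<times> {..<2::nat}. bij_betw f S (J \<times> {..<2}) \<and> fibre_matching S J f = P}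
    = 2 ^ card J * fact (card J)"
proof -
  have part: "partition_on S P" and card2: "\<And>e. e \<in> P \<Longrightarrow> card e = 2"
    using P by (auto simp: perfect_matchings_def)
  have finP: "finite P" using finite_elements[OF fin(1) part] .
  have PS: "e \<subseteq> S" if "e \<in> P" for e using part that by (auto simp: partition_on_def)
  have "card S = (\<Sum>e\<in>P. card e)"
    by (rule product_partition[OF part finite_subset[OF PS fin(1)]])
  then have cardP: "card P = card J" using card card2 by simp
  define F where "F = {f \<in> S \<rightarrow>\<^sub>E J \<times> {..<2::nat}. bij_betw f S (J \<times> {..<2}) \<and> fibre_matching S J f = P}"
  \<comment> \<open>As \<open>P\<close> and \<open>J\<close> have the same size, injectivity already makes \<open>\<sigma>\<close> a bijection.\<close>
  define L where "L = {\<sigma> \<in> J \<rightarrow>\<^sub>E P. inj_on \<sigma> J}"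
  define B where "B = Sigma L (\<lambda>\<sigma>. Pi\<^sub>E J \<sigma>)"
  define label :: "('b \<Rightarrow> 'a set) \<Rightarrow> 'a \<Rightarrow> 'b" where "label = (\<lambda>\<sigma> s. THE j. j \<in> J \<and> s \<in> \<sigma> j)"
  define enc :: "('a \<Rightarrow> 'b \<times> nat) \<Rightarrow> ('b \<Rightarrow> 'a set) \<times> ('b \<Rightarrow> 'a)" where
    "enc = (\<lambda>f. (\<lambda>j\<in>J. {s \<in> S. fst (f s) = j}, \<lambda>j\<in>J. inv_into S f (j, 0)))"
  define dec :: "('b \<Rightarrow> 'a set) \<times> ('b \<Rightarrow> 'a) \<Rightarrow> 'a \<Rightarrow> 'b \<times> nat" where
    "dec = (\<lambda>(\<sigma>, c). \<lambda>s\<in>S. (label \<sigma> s, if s = c (label \<sigma> s) then 0 else 1))"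
  have cardL: "card L = fact (card J)"
    unfolding L_def card_inj_on_subset_funcset[OF fin(2) finP subset_refl] cardP
    by (simp add: fact_prod_rev)
  have "card (Pi\<^sub>E J \<sigma>) = 2 ^ card J" if "\<sigma> \<in> L" for \<sigma>
  proof -
    have "card (Pi\<^sub>E J \<sigma>) = (\<Prod>j\<in>J. card (\<sigma> j))" by (rule card_PiE[OF fin(2)])
    also have "\<dots> = (\<Prod>j\<in>J. 2)"
      using that card2 by (intro prod.cong) (auto simp: L_def)
    finally show ?thesis by simp
  qed
  moreover have "finite L"
    unfolding L_def using fin(2) finP by (simp add: finite_PiE)
  moreover have "finite (Pi\<^sub>E J \<sigma>)" if "\<sigma> \<in> L" for \<sigma>
    using that fin PS by (intro finite_PiE) (auto simp: L_def intro: finite_subset)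
  ultimately have cardB: "card B = 2 ^ card J * fact (card J)"
    unfolding B_def using cardL by simp
  have encF: "enc f \<in> B \<and> dec (enc f) = f" if "f \<in> F" for f
  proof -
    have f: "f \<in> S \<rightarrow>\<^sub>E J \<times> {..<2}" "bij_betw f S (J \<times> {..<2})" "fibre_matching S J f = P"
      using that by (auto simp: F_def)
    define fib where "fib = (\<lambda>j\<in>J. {s \<in> S. fst (f s) = j})"
    define c where "c = (\<lambda>j\<in>J. inv_into S f (j, 0))"
    have img: "fib ` J = P"
      using f(3) by (simp add: fibre_matching_def fib_def)
    then have "inj_on fib J" by (intro eq_card_imp_inj_on[OF fin(2)]) (simp add: cardP)
    then have "fib \<in> L" using img by (auto simp: L_def fib_def)
    have c: "c j \<in> S" "f (c j) = (j, 0)" if "j \<in> J" for j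
    proof -
      have "(j, 0) \<in> f ` S" using f(2) that by (auto simp: bij_betw_def)
      then show "c j \<in> S" "f (c j) = (j, 0)"
        using that by (simp_all add: c_def inv_into_into f_inv_into_f)
    qed
    then have "c \<in> Pi\<^sub>E J fib" by (auto simp: fib_def c_def)
    with \<open>fib \<in> L\<close> have "enc f \<in> B" by (simp add: B_def enc_def fib_def c_def)
    have "dec (fib, c) s = f s" for s
    proof (cases "s \<in> S")
      case True
      then have fs: "fst (f s) \<in> J" "snd (f s) < 2"
        using bij_betw_apply[OF f(2)] by (auto simp: mem_Times_iff)
      have "label fib s = fst (f s)"
        unfolding label_def using True fs by (intro the_equality) (auto simp: fib_def)
      moreover have "s = c (fst (f s)) \<longleftrightarrow> snd (f s) = 0"
      proof
        assume "snd (f s) = 0"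
        then have "f s = f (c (fst (f s)))" using c(2)[OF fs(1)] by (simp add: prod_eq_iff)
        then show "s = c (fst (f s))"
          by (rule inj_onD[OF bij_betw_imp_inj_on[OF f(2)] _ True c(1)[OF fs(1)]])
      next
        assume "s = c (fst (f s))"
        then have "f s = f (c (fst (f s)))" by (rule arg_cong)
        also note c(2)[OF fs(1)]
        finally show "snd (f s) = 0" by (rule arg_cong[where f = snd, THEN trans]) (rule snd_conv)
      qed
      ultimately show ?thesis
        using True fs by (auto simp: dec_def less_2_cases_iff prod_eq_iff)
    next
      case False
      then show ?thesis using PiE_arb[OF f(1) False] by (simp add: dec_def)
    qed
    then have "dec (fib, c) = f" by (rule ext)
    moreover have "enc f = (fib, c)" by (simp only: enc_def fib_def c_def)
    ultimately show ?thesis using \<open>enc f \<in> B\<close> by simp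
  qed
  have decB: "dec b \<in> F \<and> enc (dec b) = b" if "b \<in> B" for b
  proof -
    obtain \<sigma> c where b: "b = (\<sigma>, c)" "\<sigma> \<in> L" "c \<in> Pi\<^sub>E J \<sigma>" using \<open>b \<in> B\<close> by (auto simp: B_def)
    have cE: "c \<in> extensional J" using b(3) by (simp add: PiE_def)
    have \<sigma>: "\<sigma> \<in> J \<rightarrow>\<^sub>E P" "inj_on \<sigma> J" using b by (auto simp: L_def)
    then have \<sigma>P: "\<sigma> ` J = P"
      using card_image[OF \<sigma>(2)] cardP by (intro card_subset_eq[OF finP]) auto
    have \<sigma>J: "\<sigma> j \<in> P" if "j \<in> J" for j using \<sigma>(1) that by auto
    have cj: "c j \<in> \<sigma> j" if "j \<in> J" for j using b(3) that by auto
    have label: "label \<sigma> s = j" if "j \<in> J" "s \<in> \<sigma> j" for s j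
      unfolding label_def
    proof (rule the_equality)
      fix i assume i: "i \<in> J \<and> s \<in> \<sigma> i"
      then have "\<sigma> i \<inter> \<sigma> j \<noteq> {}" using that(2) by blast
      then have "\<sigma> i = \<sigma> j"
        using disjointD[OF partition_onD2[OF part] \<sigma>J[of i] \<sigma>J[OF that(1)]] i by blast
      then show "i = j" by (rule inj_onD[OF \<sigma>(2) _ conjunct1[OF i] that(1)])
    qed (use that in simp)
    have labelS: "label \<sigma> s \<in> J \<and> s \<in> \<sigma> (label \<sigma> s)" if s: "s \<in> S" for s
    proof -
      obtain j where "j \<in> J" "s \<in> \<sigma> j"
        using s partition_onD1[OF part] \<sigma>P by blast
      then show ?thesis using label by simp
    qed
    define f where "f = dec (\<sigma>, c)"
    have f: "f s = (label \<sigma> s, if s = c (label \<sigma> s) then 0 else 1)" if "s \<in> S" for s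
      using that by (simp add: f_def dec_def)
    have fPi: "f \<in> S \<rightarrow>\<^sub>E J \<times> {..<2}"
      using labelS by (auto simp: f_def dec_def)
    have fib: "{s \<in> S. fst (f s) = j} = \<sigma> j" if "j \<in> J" for j
    proof (intro equalityI subsetI)
      fix s assume "s \<in> {s \<in> S. fst (f s) = j}"
      then have "s \<in> S" "label \<sigma> s = j" using f[of s] by simp_all
      then show "s \<in> \<sigma> j" using labelS[of s] by simp
    next
      fix s assume s: "s \<in> \<sigma> j"
      then have "s \<in> S" using PS[OF \<sigma>J[OF that]] by blast
      then show "s \<in> {s \<in> S. fst (f s) = j}" using f[of s] label[OF that s] by simp
    qed
    have inj: "inj_on f S"
    proof (rule inj_onI)
      fix s s' assume ss: "s \<in> S" "s' \<in> S" "f s = f s'"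
      define j where "j = label \<sigma> s"
      have j: "j \<in> J" "s \<in> \<sigma> j" "s' \<in> \<sigma> j" "label \<sigma> s' = j"
        using labelS[OF ss(1)] labelS[OF ss(2)] ss(3) f[OF ss(1)] f[OF ss(2)] by (simp_all add: j_def)
      have "f s = (j, if s = c j then 0 else 1)" "f s' = (j, if s' = c j then 0 else 1)"
        using f[OF ss(1)] f[OF ss(2)] unfolding j(4) j_def[symmetric] .
      then have "(if s = c j then 0 else 1::nat) = (if s' = c j then 0 else 1)"
        unfolding ss(3) by simp
      then have or: "s = c j \<longleftrightarrow> s' = c j"
        by (cases "s = c j"; cases "s' = c j"; simp only: if_True if_False simp_thms zero_neq_one one_neq_zero)
      \<comment> \<open>Pairs have two elements, so at most one element of \<open>\<sigma> j\<close> is sent to side \<open>1\<close>.\<close>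
      have "card (\<sigma> j - {c j}) = 1"
        using card2[OF \<sigma>J[OF j(1)]] cj[OF j(1)] by simp
      then obtain d where d: "\<sigma> j - {c j} = {d}" by (auto simp: card_1_singleton_iff)
      show "s = s'"
      proof (cases "s = c j")
        case False
        then have "s \<in> \<sigma> j - {c j}" "s' \<in> \<sigma> j - {c j}" using or j by auto
        then show ?thesis unfolding d by simp
      qed (use or in simp)
    qed
    have "f ` S = J \<times> {..<2}"
    proof (rule card_subset_eq)
      show "finite (J \<times> {..<2::nat})" using fin(2) by simp
      show "f ` S \<subseteq> J \<times> {..<2}" using PiE_mem[OF fPi] by blast
      show "card (f ` S) = card (J \<times> {..<2::nat})"
        by (simp add: card_image[OF inj] card card_cartesian_product)
    qed
    with inj have bij: "bij_betw f S (J \<times> {..<2})" by (simp add: bij_betw_def)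
    have "fibre_matching S J f = P"
      unfolding fibre_matching_def \<sigma>P[symmetric] by (rule image_cong[OF refl fib])
    then have "f \<in> F" using fPi bij by (simp add: F_def)
    moreover have "inv_into S f (j, 0) = c j" if "j \<in> J" for j
    proof (rule inv_into_f_eq[OF inj])
      show "c j \<in> S" using cj[OF that] PS[OF \<sigma>J[OF that]] by auto
      from f[OF this] show "f (c j) = (j, 0)" using label[OF that cj[OF that]] by simp
    qed
    then have "(\<lambda>j\<in>J. inv_into S f (j, 0)) = c"
      by (intro extensionalityI[OF restrict_extensional cE]) simp
    moreover have "(\<lambda>j\<in>J. {s \<in> S. fst (f s) = j}) = \<sigma>"
      by (rule extensionalityI[OF restrict_extensional]) (use \<sigma>(1) fib in \<open>auto simp: PiE_def\<close>)
    ultimately show ?thesis by (simp add: b enc_def flip: f_def)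
  qed
  have "bij_betw enc F B"
    by (rule bij_betw_byWitness[of _ dec]) (use encF decB in auto)
  then have "card F = card B" by (rule bij_betw_same_card)
  then show ?thesis unfolding F_def cardB .
qed

theorem proposition5p1:
  fixes k g :: nat
  assumes "k \<ge> 1"
  shows "eps_bip g k 2 = 2 ^ k * fact k * eps g k"
proof -
  define n :: "nat \<Rightarrow> nat" where "n = (\<lambda>j. if j = 0 then k * 2 else 2)"
  define S where "S = sides n {0}"
  define M where "M = {P \<in> perfect_matchings S.
    has_genus (glued_surface (\<lambda>_. 2 * k) {0} {(s, s'). {s, s'} \<in> P}) g}"
  define F where "F = (\<lambda>P. {f \<in> S \<rightarrow>\<^sub>E {1..k} \<times> {..<2::nat}.
    bij_betw f S ({1..k} \<times> {..<2}) \<and> fibre_matching S {1..k} f = P})"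
  have S: "S = {0} \<times> {..<2 * k}"
    by (auto simp: S_def sides_def n_def)
  then have finS: "finite S" and cardS: "card S = 2 * card {1..k}"
    by (simp_all add: card_cartesian_product)
  have bigons: "sides n {1..k} = {1..k} \<times> {..<2}"
    by (auto simp: sides_def n_def)
  have genus: "has_genus (glued_surface n {0..k} {(s, f s) |s. s \<in> S}) g \<longleftrightarrow> fibre_matching S {1..k} f \<in> M"
    if f: "bij_betw f S ({1..k} \<times> {..<2})" for f
  proof -
    interpret bigon_gluing k n f
    proof
      show "k > 0" using assms by simp
      show "bij_betw f (sides n {0}) (sides n {1..k})"
        using f unfolding bigons S_def .
    qed (rule n_def)
    have "{(s, s'). {s, s'} \<in> fibre_matching S {1..k} f} = matching_pairs"
      by (simp only: pair_in_fibre_matching[OF f] S_def[symmetric])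
    then show ?thesis
      using has_genus_homeomorphic[OF glued_bigons_homeomorphic, of g] fibre_matching_perfect[OF f]
      by (simp add: M_def flip: S_def)
  qed
  have finM: "finite M"
  proof (rule finite_subset)
    show "M \<subseteq> Pow (Pow S)"
      by (auto simp: M_def perfect_matchings_def partition_on_def)
  qed (simp add: finS)
  have "eps_bip g k 2 = card {f \<in> S \<rightarrow>\<^sub>E {1..k} \<times> {..<2}. bij_betw f S ({1..k} \<times> {..<2}) \<and>
      has_genus (glued_surface n {0..k} {(s, f s) |s. s \<in> S}) g}"
    by (simp only: eps_bip_def Let_def bigons[unfolded n_def] n_def S_def)
  also have "\<dots> = card (\<Union>P\<in>M. F P)"
    unfolding F_def using genus by (intro arg_cong[where f = card]) blast
  also have "\<dots> = (\<Sum>P\<in>M. card (F P))"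
  proof (rule card_UN_disjoint[OF finM])
    show "\<forall>P\<in>M. finite (F P)"
    proof
      fix P
      have "finite (S \<rightarrow>\<^sub>E {1..k} \<times> {..<2::nat})" by (rule finite_PiE[OF finS]) simp
      then show "finite (F P)" by (rule finite_subset[rotated]) (auto simp: F_def)
    qed
  qed (auto simp: F_def)
  also have "\<dots> = (\<Sum>P\<in>M. 2 ^ k * fact k)"
    using card_bijections_with_fibre_matching[OF finS _ _ cardS]
    by (intro sum.cong) (simp_all add: F_def M_def)
  also have "\<dots> = 2 ^ k * fact k * card M" by simp
  also have "card M = eps g k"
    using S by (simp add: M_def eps_def sides_def Let_def)
  finally show ?thesis .
qed

end
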